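(* Let $k\ge 2$ and $\sigma\in\{+,-\}^k$ with $\sigma\neq -^k$ (i.e. not all entries equal to $-$). Then for every $n\ge 1$ and every permutation $\pi\in\mathcal S_n$, we have $\pi\in\mathcal P(\Sigma_\sigma)$ if and only if $\hat\pi\in\mathcal C^\sigma$.
   Context: Fix $k\ge2$ and $\sigma=\sigma_0\sigma_1\dots\sigma_{k-1}\in\{+,-\}^k$; let $T^-_\sigma=\{t:\sigma_t=-\}$. Let $\mathcal W_k$ be the set of infinite words $s=s_1s_2\dots$ over $\{0,1,\dots,k-1\}$, and write $s_{[i,\infty)}=s_is_{i+1}\dots$. Define a linear order $\prec_\sigma$ on $\mathcal W_k$: for $s\neq t$, let $j$ be the first index with $s_j\ne t_j$ and $c=|\{i<j: s_i\in T^-_\sigma\}|$; then $s\prec_\sigma t$ iff either $c$ is even and $s_j<t_j$, or $c$ is odd and $s_j>t_j$. The signed shift $\Sigma_\sigma:\mathcal W_k\to\mathcal W_k$ is $\Sigma_\sigma(s_1s_2s_3\dots)=s_2s_3\dots$. A finite word is primitive if it is not a concatenation of two or more copies of a shorter word; $q^\infty$ denotes the infinite periodic word $qqq\dots$. Let $\mathcal W_{k,n}$ be the set of words $(s_1\dots s_n)^\infty$ with $s_1\dots s_n$ primitive (the $n$-periodic points of $\Sigma_\sigma$). For $s\in\mathcal W_{k,n}$, the periodic pattern $\Pi_\sigma(s)\in\mathcal S_n$ is the permutation with $\Pi_\sigma(s)_i<\Pi_\sigma(s)_j$ iff $s_{[i,\infty)}\prec_\sigma s_{[j,\infty)}$ ($1\le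 i,j\le n$). Let $\mathcal P_n(\Sigma_\sigma)=\{\Pi_\sigma(s):s\in\mathcal W_{k,n}\}$ and $\mathcal P(\Sigma_\sigma)=\bigcup_{n\ge1}\mathcal P_n(\Sigma_\sigma)$. For $\pi=\pi_1\dots\pi_n\in\mathcal S_n$ (one-line notation), $\hat\pi$ is the cyclic permutation with cycle notation $(\pi_1,\pi_2,\dots,\pi_n)$, i.e. $\hat\pi_{\pi_i}=\pi_{i+1}$ with $\pi_{n+1}=\pi_1$. A $\sigma$-segmentation of $\tau\in\mathcal S_n$ is a sequence $0=e_0\le e_1\le\dots\le e_k=n$ such that for each $0\le t<k$ the segment $\tau_{e_t+1}\dots\tau_{e_{t+1}}$ is increasing if $\sigma_t=+$ and decreasing if $\sigma_t=-$. $\mathcal S^\sigma$ is the set of permutations (of any length) admitting a $\sigma$-segmentation, and $\mathcal C^\sigma$ is the set of cyclic permutations (permutations consisting of a single cycle) in $\mathcal S^\sigma$. *)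

theory Defs
  imports
    "HOL-Library.Stream"
    "HOL-Combinatorics.Cycles"
    "HOL-Combinatorics.Orbits"
    "HOL-Combinatorics.Multiset_Permutations"
begin

text \<open>
  Infinite words are streams, so the letter $s_i$ is \<open>s !! (i - 1)\<close> and the suffix
  $s_{[i,\infty)}$ is \<open>sdrop (i - 1) s\<close>. A sign vector of length $k$ is a list of length $k$;
  \<open>k\<close> is recovered as \<open>length \<sigma>\<close>.
\<close>

datatype sign = Plus | Minus

definition neg_letters :: "sign list \<Rightarrow> nat set" where
  "neg_letters \<sigma> = {t. t < length \<sigma> \<and> \<sigma> ! t = Minus}"

definition words :: "nat \<Rightarrow> nat stream set" where
  "words k = streams {..<k}"

definition word_less :: "sign list \<Rightarrow> nat stream \<Rightarrow> nat stream \<Rightarrow> bool" where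
  "word_less \<sigma> s t \<longleftrightarrow> s \<noteq> t \<and>
    (let j = (LEAST j. s !! j \<noteq> t !! j);
         c = card {i. i < j \<and> s !! i \<in> neg_letters \<sigma>}
     in (even c \<and> s !! j < t !! j) \<or> (odd c \<and> s !! j > t !! j))"

definition primitive_word :: "'a list \<Rightarrow> bool" where
  "primitive_word u \<longleftrightarrow> u \<noteq> [] \<and>
    \<not> (\<exists>v m. 2 \<le> m \<and> length v < length u \<and> u = concat (replicate m v))"

definition periodic_words :: "nat \<Rightarrow> nat \<Rightarrow> nat stream set" where
  "periodic_words k n =
    {s \<in> words k. \<exists>u. length u = n \<and> primitive_word u \<and> s = Stream.cycle u}"

text \<open>
  Permutations are lists in one-line notation, not functions on \<^typ>\<open>nat\<close>: as functions, the
  members of $S_n$ fixing $n$ would coincide with members of $S_{n-1}$, and the unions over all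
  lengths below would identify them.
\<close>

abbreviation perms :: "nat \<Rightarrow> nat list set" where
  "perms n \<equiv> permutations_of_set {1..n}"

definition entry :: "nat list \<Rightarrow> nat \<Rightarrow> nat" where
  "entry \<pi> i = \<pi> ! (i - 1)"

text \<open>
  The description is proper for \<open>s \<in> periodic_words (length \<sigma>) n\<close>: the first \<open>n\<close> suffixes of
  \<open>s\<close> are then pairwise distinct.
\<close>

definition periodic_pattern :: "sign list \<Rightarrow> nat \<Rightarrow> nat stream \<Rightarrow> nat list" where
  "periodic_pattern \<sigma> n s = (THE \<pi>. \<pi> \<in> perms n \<and>
    (\<forall>i\<in>{1..n}. \<forall>j\<in>{1..n}.
       entry \<pi> i < entry \<pi> j \<longleftrightarrow> word_less \<sigma> (sdrop (i - 1) s) (sdrop (j - 1) s)))"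

definition patterns_of_length :: "sign list \<Rightarrow> nat \<Rightarrow> nat list set" where
  "patterns_of_length \<sigma> n = periodic_pattern \<sigma> n ` periodic_words (length \<sigma>) n"

definition patterns :: "sign list \<Rightarrow> nat list set" where
  "patterns \<sigma> = (\<Union>n\<in>{1..}. patterns_of_length \<sigma> n)"

definition hat :: "nat list \<Rightarrow> nat list" where
  "hat \<pi> = map (cycle_of_list \<pi>) [1..<Suc (length \<pi>)]"

definition segmentation :: "sign list \<Rightarrow> nat list \<Rightarrow> (nat \<Rightarrow> nat) \<Rightarrow> bool" where
  "segmentation \<sigma> \<tau> e \<longleftrightarrow>
    e 0 = 0 \<and> e (length \<sigma>) = length \<tau> \<and>
    (\<forall>t<length \<sigma>. e t \<le> e (Suc t)) \<and>
    (\<forall>t<length \<sigma>. case \<sigma> ! t of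
        Plus \<Rightarrow> strict_mono_on {e t + 1..e (Suc t)} (entry \<tau>)
      | Minus \<Rightarrow> strict_antimono_on {e t + 1..e (Suc t)} (entry \<tau>))"

definition segmented_perms :: "sign list \<Rightarrow> nat list set" where
  "segmented_perms \<sigma> = {\<tau>. \<tau> \<in> (\<Union>n. perms n) \<and> (\<exists>e. segmentation \<sigma> \<tau> e)}"

definition cyclic_perm :: "nat list \<Rightarrow> bool" where
  "cyclic_perm \<tau> \<longleftrightarrow> cyclic_on (entry \<tau>) {1..length \<tau>}"

definition cyclic_segmented_perms :: "sign list \<Rightarrow> nat list set" where
  "cyclic_segmented_perms \<sigma> = {\<tau> \<in> segmented_perms \<sigma>. cyclic_perm \<tau>}"

end

theory Submission
  imports Defs
begin

text \<open>
  Let $f = \hat\pi$. A $\sigma$-segmentation of $f$ assigns to every position the index of its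
  segment, and the word attached to it is the itinerary of $\pi_1$ under $f$. Comparing itineraries
  letter by letter shows that $\prec_\sigma$ on them agrees with the order of the positions, so
  $\pi$ is the pattern of the word as soon as distinct positions have distinct itineraries.
  Conversely, grouping positions by first letter turns a periodic word into a segmentation.

  If two positions $x$ and $f^d(x)$ with $0 < d < n$ have the same itinerary, then $f^d$ is monotone
  on the set of positions with that itinerary. It cannot be increasing, since an increasing map has
  no nontrivial periodic points; if it is decreasing, its square is the identity there, whence
  $n = 2d$ and the segment index is invariant under $f^d$. In that case a letter $-$ occurs, and as
  $\sigma \neq -^k$ a boundary between segments of opposite sign can be shifted by one step; this
  changes the index of exactly one position and destroys the invariance.
\<close>

section \<open>The word order and periodic patterns\<close>

lemma word_less_at:
  assumes "s !! j \<noteq> t !! j" and "\<And>i. i < j \<Longrightarrow> s !! i = t !! i"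
  shows "word_less \<sigma> s t \<longleftrightarrow>
    (if even (card {i. i < j \<and> s !! i \<in> neg_letters \<sigma>}) then s !! j < t !! j else s !! j > t !! j)"
proof -
  have "(LEAST j. s !! j \<noteq> t !! j) = j"
    using assms by (metis (mono_tags, lifting) LeastI Least_le le_neq_implies_less)
  moreover have "s \<noteq> t" using assms(1) by auto
  ultimately show ?thesis by (simp add: word_less_def Let_def)
qed

lemma first_difference:
  assumes "s \<noteq> t"
  obtains j where "s !! j \<noteq> t !! j" and "\<And>i. i < j \<Longrightarrow> s !! i = t !! i"
proof -
  have "\<exists>j. s !! j \<noteq> t !! j"
    using assms smap_alt[of id s t] by (auto simp: stream.map_id)
  then have "s !! (LEAST j. s !! j \<noteq> t !! j) \<noteq> t !! (LEAST j. s !! j \<noteq> t !! j)"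
    by (rule LeastI_ex)
  then show thesis
    by (rule that) (use not_less_Least in blast)
qed

lemma word_less_irrefl [simp]: "\<not> word_less \<sigma> s s"
  by (simp add: word_less_def)

text \<open>A negative head adds one to the parity count at every later index, which amounts to
  exchanging the two tails. The recursion lets the inductions below proceed head by head instead of
  counting signs.\<close>

lemma word_less_unfold:
  "word_less \<sigma> s t \<longleftrightarrow> shd s < shd t \<or> shd s = shd t \<and>
    (if shd s \<in> neg_letters \<sigma> then word_less \<sigma> (stl t) (stl s) else word_less \<sigma> (stl s) (stl t))"
proof (cases "shd s = shd t")
  case False
  then show ?thesis using word_less_at[of s 0 t \<sigma>] by auto
next
  case True
  show ?thesis
  proof (cases "stl s = stl t")
    case eq: True
    with True have "s = t" by (simp add: stream.expand)
    then show ?thesis by simp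
  next
    case False
    then obtain j where j: "stl s !! j \<noteq> stl t !! j" "\<And>i. i < j \<Longrightarrow> stl s !! i = stl t !! i"
      by (rule first_difference) blast
    let ?N = "neg_letters \<sigma>"
    let ?C = "{i. i < j \<and> stl s !! i \<in> ?N}"
    have "{i. i < Suc j \<and> s !! i \<in> ?N} = (if shd s \<in> ?N then {0} else {}) \<union> Suc ` ?C"
      by (auto simp: less_Suc_eq_0_disj)
    then have card_eq: "card {i. i < Suc j \<and> s !! i \<in> ?N} = (if shd s \<in> ?N then 1 else 0) + card ?C"
      by (auto simp: card_image)
    have C_eq: "{i. i < j \<and> stl t !! i \<in> ?N} = ?C"
      using j(2) by auto
    have agree: "s !! i = t !! i" if "i < Suc j" for i
      using that j(2) True by (cases i) auto
    have less_st: "word_less \<sigma> s t \<longleftrightarrow> (if even (card {i. i < Suc j \<and> s !! i \<in> ?N})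
        then stl s !! j < stl t !! j else stl s !! j > stl t !! j)"
      using word_less_at[of s "Suc j" t \<sigma>, OF _ agree] j(1) by simp
    show ?thesis
      using j(1) True word_less_at[OF j, of \<sigma>] word_less_at[of "stl t" j "stl s" \<sigma>] j(2)
      unfolding less_st card_eq by (auto simp: C_eq)
  qed
qed

lemma word_less_linear: "s \<noteq> t \<Longrightarrow> word_less \<sigma> s t \<longleftrightarrow> \<not> word_less \<sigma> t s"
proof -
  assume "s \<noteq> t"
  then obtain j where j: "s !! j \<noteq> t !! j" "\<And>i. i < j \<Longrightarrow> s !! i = t !! i"
    by (rule first_difference) blast
  have "{i. i < j \<and> t !! i \<in> neg_letters \<sigma>} = {i. i < j \<and> s !! i \<in> neg_letters \<sigma>}"
    using j(2) by auto
  then show ?thesis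
    using word_less_at[OF j, of \<sigma>] word_less_at[of t j s \<sigma>] j by auto
qed

lemma word_less_trans:
  assumes "word_less \<sigma> s t" and "word_less \<sigma> t u"
  shows "word_less \<sigma> s u"
proof -
  \<comment> \<open>Both orientations are proved together, since a negative head turns the claim
    about the tails round. The index \<open>j\<close> is any place where \<open>s\<close> and
    \<open>t\<close> differ, so it simply decreases on passing to tails.\<close>
  have "(word_less \<sigma> s t \<longrightarrow> word_less \<sigma> t u \<longrightarrow> word_less \<sigma> s u) \<and>
        (word_less \<sigma> t s \<longrightarrow> word_less \<sigma> u t \<longrightarrow> word_less \<sigma> u s)"
    if "s !! j \<noteq> t !! j" for j s t u
    using that
  proof (induction j arbitrary: s t u)
    case 0
    show ?case
    proof (intro conjI impI)
      assume "word_less \<sigma> s t" "word_less \<sigma> t u"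
      then show "word_less \<sigma> s u"
        using 0 unfolding word_less_unfold[of \<sigma> s t] word_less_unfold[of \<sigma> t u]
          word_less_unfold[of \<sigma> s u] by auto
    next
      assume "word_less \<sigma> t s" "word_less \<sigma> u t"
      then show "word_less \<sigma> u s"
        using 0 unfolding word_less_unfold[of \<sigma> t s] word_less_unfold[of \<sigma> u t]
          word_less_unfold[of \<sigma> u s] by auto
    qed
  next
    case (Suc j)
    then have IH: "(word_less \<sigma> (stl s) (stl t) \<longrightarrow> word_less \<sigma> (stl t) (stl u) \<longrightarrow> word_less \<sigma> (stl s) (stl u)) \<and>
        (word_less \<sigma> (stl t) (stl s) \<longrightarrow> word_less \<sigma> (stl u) (stl t) \<longrightarrow> word_less \<sigma> (stl u) (stl s))"
      by simp
    show ?case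
    proof (intro conjI impI)
      assume "word_less \<sigma> s t" "word_less \<sigma> t u"
      then show "word_less \<sigma> s u"
        using IH unfolding word_less_unfold[of \<sigma> s t] word_less_unfold[of \<sigma> t u]
          word_less_unfold[of \<sigma> s u]
        by (auto split: if_splits)
    next
      assume "word_less \<sigma> t s" "word_less \<sigma> u t"
      then show "word_less \<sigma> u s"
        using IH unfolding word_less_unfold[of \<sigma> t s] word_less_unfold[of \<sigma> u t]
          word_less_unfold[of \<sigma> u s]
        by (auto split: if_splits)
    qed
  qed
  moreover have "s \<noteq> t" using assms(1) by auto
  ultimately show ?thesis
    using assms first_difference[of s t] by metis
qed

section \<open>Permutations and linear orders\<close>

lemma perms_iff: "\<pi> \<in> perms n \<longleftrightarrow> length \<pi> = n \<and> distinct \<pi> \<and> set \<pi> = {1..n}"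
  using distinct_card[of \<pi>] by (auto simp: permutations_of_set_def)

lemma bij_betw_entry:
  assumes "\<pi> \<in> perms n"
  shows "bij_betw (entry \<pi>) {1..n} {1..n}"
proof -
  have \<pi>: "length \<pi> = n" "distinct \<pi>" "set \<pi> = {1..n}" using assms unfolding perms_iff by auto
  have "inj_on (entry \<pi>) {1..n}"
    using \<pi> by (auto simp: inj_on_def entry_def nth_eq_iff_index_eq)
  moreover have "entry \<pi> ` {1..n} \<subseteq> {1..n}"
  proof (intro image_subsetI)
    fix i assume "i \<in> {1..n}"
    then have "\<pi> ! (i - 1) \<in> set \<pi>" using \<pi>(1) by (intro nth_mem) auto
    then show "entry \<pi> i \<in> {1..n}" using \<pi>(3) by (simp add: entry_def)
  qed
  ultimately show ?thesis by (simp add: bij_betw_def endo_inj_surj)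
qed

text \<open>An entry is one more than the number of smaller entries, so the order relation alone
  recovers it.\<close>

lemma perm_determined_by_order:
  assumes "\<pi> \<in> perms n" and "\<rho> \<in> perms n"
    and "\<And>i j. i \<in> {1..n} \<Longrightarrow> j \<in> {1..n} \<Longrightarrow> entry \<pi> i < entry \<pi> j \<longleftrightarrow> entry \<rho> i < entry \<rho> j"
  shows "\<pi> = \<rho>"
proof -
  have rank: "entry \<pi> i = Suc (card {j \<in> {1..n}. entry \<pi> j < entry \<pi> i})"
    if "\<pi> \<in> perms n" "i \<in> {1..n}" for \<pi> i
  proof -
    note bij = bij_betw_entry[OF that(1)]
    have i: "entry \<pi> i \<in> {1..n}" using bij that(2) by (rule bij_betw_apply)
    have "entry \<pi> ` {j \<in> {1..n}. entry \<pi> j < entry \<pi> i} = entry \<pi> ` {1..n} \<inter> {..<entry \<pi> i}"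
      by blast
    also have "\<dots> = {1..n} \<inter> {..<entry \<pi> i}"
      using bij by (simp add: bij_betw_def)
    also have "\<dots> = {1..<entry \<pi> i}" using i by auto
    finally have im: "entry \<pi> ` {j \<in> {1..n}. entry \<pi> j < entry \<pi> i} = {1..<entry \<pi> i}" .
    have "inj_on (entry \<pi>) {j \<in> {1..n}. entry \<pi> j < entry \<pi> i}"
      by (rule inj_on_subset[OF bij_betw_imp_inj_on[OF bij]]) blast
    then have "card {j \<in> {1..n}. entry \<pi> j < entry \<pi> i} = entry \<pi> i - 1"
      using card_image im by (metis card_atLeastLessThan)
    then show ?thesis using i by simp
  qed
  have "entry \<pi> i = entry \<rho> i" if "i \<in> {1..n}" for i
  proof -
    have "{j \<in> {1..n}. entry \<pi> j < entry \<pi> i} = {j \<in> {1..n}. entry \<rho> j < entry \<rho> i}"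
      using assms(3) that by auto
    then show ?thesis using rank[OF assms(1) that] rank[OF assms(2) that] by simp
  qed
  from this[of "Suc i" for i] have "\<pi> ! i = \<rho> ! i" if "i < n" for i
    using that by (simp add: entry_def)
  then show ?thesis
    using assms(1,2) unfolding perms_iff by (intro nth_equalityI) auto
qed

lemma ex_perm_of_order:
  fixes R :: "nat \<Rightarrow> nat \<Rightarrow> bool"
  assumes irrefl: "\<And>i. \<not> R i i"
    and trans: "\<And>i j l. R i j \<Longrightarrow> R j l \<Longrightarrow> R i l"
    and total: "\<And>i j. i \<in> {1..n} \<Longrightarrow> j \<in> {1..n} \<Longrightarrow> i \<noteq> j \<Longrightarrow> R i j \<or> R j i"
  shows "\<exists>\<pi>\<in>perms n. \<forall>i\<in>{1..n}. \<forall>j\<in>{1..n}. entry \<pi> i < entry \<pi> j \<longleftrightarrow> R i j"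
proof -
  \<comment> \<open>\<open>r i\<close> is the rank of \<open>i\<close>; counting \<open>i\<close>
    itself makes the ranks start at 1.\<close>
  define r where "r i = card {j \<in> {1..n}. R j i \<or> j = i}" for i
  have less: "r i < r j" if "i \<in> {1..n}" "j \<in> {1..n}" "R i j" for i j
    unfolding r_def
  proof (rule psubset_card_mono)
    have "j \<notin> {l \<in> {1..n}. R l i \<or> l = i}" using that irrefl trans by blast
    moreover have "{l \<in> {1..n}. R l i \<or> l = i} \<subseteq> {l \<in> {1..n}. R l j \<or> l = j}"
      using that trans by blast
    ultimately show "{l \<in> {1..n}. R l i \<or> l = i} \<subset> {l \<in> {1..n}. R l j \<or> l = j}"
      using that by blast
  qed simp
  then have iff: "r i < r j \<longleftrightarrow> R i j" if "i \<in> {1..n}" "j \<in> {1..n}" for i j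
    using total that by (metis less_asym' less_irrefl)
  have inj: "inj_on r {1..n}"
    using less total by (metis inj_onI less_irrefl)
  have "r i \<in> {1..n}" if "i \<in> {1..n}" for i
  proof -
    have "r i \<le> card {1..n}" unfolding r_def by (rule card_mono) auto
    moreover have "card {i} \<le> r i" unfolding r_def using that by (intro card_mono) auto
    ultimately show ?thesis by simp
  qed
  then have im: "r ` {1..n} = {1..n}" using inj by (intro endo_inj_surj) auto
  let ?\<pi> = "map r [1..<Suc n]"
  have "?\<pi> \<in> perms n"
    unfolding perms_iff using inj im
    by (auto simp: distinct_map atLeastLessThanSuc_atLeastAtMost simp del: upt_Suc)
  moreover have "entry ?\<pi> i = r i" if "i \<in> {1..n}" for i
    using that by (auto simp: entry_def simp del: upt_Suc)
  ultimately show ?thesis using iff by (intro bexI[of _ ?\<pi>]) auto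
qed

lemma periodic_pattern_eqI:
  assumes "\<pi> \<in> perms n"
    and "\<And>i j. i \<in> {1..n} \<Longrightarrow> j \<in> {1..n} \<Longrightarrow>
      entry \<pi> i < entry \<pi> j \<longleftrightarrow> word_less \<sigma> (sdrop (i - 1) s) (sdrop (j - 1) s)"
  shows "periodic_pattern \<sigma> n s = \<pi>"
  unfolding periodic_pattern_def
proof (rule the_equality)
  fix \<rho>
  assume "\<rho> \<in> perms n \<and> (\<forall>i\<in>{1..n}. \<forall>j\<in>{1..n}.
    entry \<rho> i < entry \<rho> j \<longleftrightarrow> word_less \<sigma> (sdrop (i - 1) s) (sdrop (j - 1) s))"
  then show "\<rho> = \<pi>"
    using assms by (intro perm_determined_by_order[of _ n]) blast+
qed (use assms in blast)

section \<open>Periods of periodic words\<close>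

lemma sdrop_mult_period: "sdrop d s = s \<Longrightarrow> sdrop (m * d) s = s"
proof (induction m)
  case (Suc m)
  have "sdrop (Suc m * d) s = sdrop (m * d) (sdrop d s)" by simp
  then show ?case using Suc by simp
qed simp

lemma stake_mult_period:
  "sdrop d s = s \<Longrightarrow> stake (m * d) s = concat (replicate m (stake d s))"
proof (induction m)
  case (Suc m)
  have "stake (Suc m * d) s = stake d s @ stake (m * d) (sdrop d s)" by simp
  then show ?case using Suc by simp
qed simp

text \<open>A coincidence of suffixes makes \<open>d = j - i\<close> a period besides the length of
  \<open>u\<close>. By Bezout their gcd is a period as well; being a proper divisor of the length,
  it exhibits \<open>u\<close> as a power.\<close>

lemma primitive_cycle_sdrop_inj:
  assumes "primitive_word u" and "i < j" and "j < length u"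
  shows "sdrop i (Stream.cycle u) \<noteq> sdrop j (Stream.cycle u)"
proof
  let ?s = "Stream.cycle u" and ?n = "length u"
  assume eq: "sdrop i ?s = sdrop j ?s"
  have u: "u \<noteq> []" using assms(1) by (simp add: primitive_word_def)
  then have n: "sdrop ?n ?s = ?s" by simp
  define d where "d = j - i"
  have d: "0 < d" "d < ?n" using assms by (auto simp: d_def)
  \<comment> \<open>Dropping \<open>?n - i\<close> further letters completes a full period on the
    left and leaves an excess of \<open>d\<close> on the right.\<close>
  have "sdrop (?n - i) (sdrop i ?s) = sdrop (?n - i) (sdrop j ?s)" using eq by simp
  then have "sdrop ?n ?s = sdrop (?n + d) ?s"
    unfolding sdrop_add using assms(2,3) by (simp add: d_def add.commute)
  also have "\<dots> = sdrop d (sdrop ?n ?s)" by simp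
  finally have sd: "sdrop d ?s = ?s" unfolding n by (rule sym)
  define g where "g = gcd d ?n"
  obtain a b where "a * d = b * ?n + g"
    using bezout_nat[of d ?n] d by (auto simp: g_def mult.commute)
  then have "sdrop (a * d) ?s = sdrop g (sdrop (b * ?n) ?s)" by (simp only: sdrop_add)
  then have g: "sdrop g ?s = ?s" unfolding sdrop_mult_period[OF n] sdrop_mult_period[OF sd] by (rule sym)
  obtain m where m: "?n = m * g" unfolding g_def by (metis dvd_def gcd_dvd2 mult.commute)
  have "g \<le> d" using d by (simp add: g_def)
  then have "m \<noteq> 0" "m \<noteq> 1" using m d by (auto intro!: gr0I)
  then have "2 \<le> m" by simp
  moreover have "u = concat (replicate m (stake g ?s))"
    using stake_mult_period[OF g, of m] m u by (metis stake_cycle_eq)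
  moreover have "length (stake g ?s) < ?n" using \<open>g \<le> d\<close> d by simp
  ultimately show False using assms(1) by (auto simp: primitive_word_def)
qed

text \<open>Justifies the definite description in \<open>periodic_pattern\<close>: primitivity
  separates the first \<open>n\<close> suffixes, so the word order is total on them and comes from a
  permutation.\<close>

lemma periodic_pattern:
  assumes "s \<in> periodic_words k n"
  shows "periodic_pattern \<sigma> n s \<in> perms n"
    and "i \<in> {1..n} \<Longrightarrow> j \<in> {1..n} \<Longrightarrow>
      entry (periodic_pattern \<sigma> n s) i < entry (periodic_pattern \<sigma> n s) j \<longleftrightarrow>
      word_less \<sigma> (sdrop (i - 1) s) (sdrop (j - 1) s)"
proof -
  obtain u where u: "length u = n" "primitive_word u" "s = Stream.cycle u"
    using assms by (auto simp: periodic_words_def)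
  have ne: "sdrop (i - 1) s \<noteq> sdrop (j - 1) s" if "i \<in> {1..n}" "j \<in> {1..n}" "i < j" for i j
    unfolding u(3) by (rule primitive_cycle_sdrop_inj) (use that u in auto)
  have total: "word_less \<sigma> (sdrop (i - 1) s) (sdrop (j - 1) s) \<or> word_less \<sigma> (sdrop (j - 1) s) (sdrop (i - 1) s)"
    if "i \<in> {1..n}" "j \<in> {1..n}" "i \<noteq> j" for i j
    using ne[OF that(1,2)] ne[OF that(2,1)] that(3) word_less_linear linorder_neqE_nat by metis
  have "\<exists>\<pi>\<in>perms n. \<forall>i\<in>{1..n}. \<forall>j\<in>{1..n}. entry \<pi> i < entry \<pi> j \<longleftrightarrow>
      word_less \<sigma> (sdrop (i - 1) s) (sdrop (j - 1) s)"
    by (rule ex_perm_of_order) (use total word_less_trans in auto)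
  then obtain \<pi> where \<pi>: "\<pi> \<in> perms n" "\<forall>i\<in>{1..n}. \<forall>j\<in>{1..n}. entry \<pi> i < entry \<pi> j \<longleftrightarrow>
      word_less \<sigma> (sdrop (i - 1) s) (sdrop (j - 1) s)"
    by blast
  then have "periodic_pattern \<sigma> n s = \<pi>" by (intro periodic_pattern_eqI) auto
  then show "periodic_pattern \<sigma> n s \<in> perms n"
    and "i \<in> {1..n} \<Longrightarrow> j \<in> {1..n} \<Longrightarrow>
      entry (periodic_pattern \<sigma> n s) i < entry (periodic_pattern \<sigma> n s) j \<longleftrightarrow>
      word_less \<sigma> (sdrop (i - 1) s) (sdrop (j - 1) s)"
    using \<pi> by auto
qed

section \<open>Segmentations as labellings\<close>

text \<open>
  \<open>\<phi>\<close> sends a position to the index of its segment, so that a \<open>\<sigma>\<close>-segmentation of \<open>f\<close> is the same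
  thing as a labelling. Moving one segment boundary by one step becomes an update at one point.
\<close>

definition labelling :: "sign list \<Rightarrow> nat \<Rightarrow> (nat \<Rightarrow> nat) \<Rightarrow> (nat \<Rightarrow> nat) \<Rightarrow> bool" where
  "labelling \<sigma> n f \<phi> \<longleftrightarrow>
    (\<forall>x\<in>{1..n}. \<phi> x < length \<sigma>) \<and>
    (\<forall>x\<in>{1..n}. \<forall>y\<in>{1..n}. x < y \<longrightarrow> \<phi> x \<le> \<phi> y) \<and>
    (\<forall>x\<in>{1..n}. \<forall>y\<in>{1..n}. x < y \<longrightarrow> \<phi> x = \<phi> y \<longrightarrow>
      (f x < f y \<longleftrightarrow> \<phi> x \<notin> neg_letters \<sigma>))"

lemma labelling_less: "labelling \<sigma> n f \<phi> \<Longrightarrow> x \<in> {1..n} \<Longrightarrow> \<phi> x < length \<sigma>"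
  unfolding labelling_def by blast

lemma labelling_mono:
  "labelling \<sigma> n f \<phi> \<Longrightarrow> x \<in> {1..n} \<Longrightarrow> y \<in> {1..n} \<Longrightarrow> x \<le> y \<Longrightarrow> \<phi> x \<le> \<phi> y"
  unfolding labelling_def by (metis le_eq_less_or_eq)

lemma labelling_sign:
  "labelling \<sigma> n f \<phi> \<Longrightarrow> x \<in> {1..n} \<Longrightarrow> y \<in> {1..n} \<Longrightarrow> x < y \<Longrightarrow> \<phi> x = \<phi> y \<Longrightarrow>
    f x < f y \<longleftrightarrow> \<phi> x \<notin> neg_letters \<sigma>"
  unfolding labelling_def by blast

lemma labelling_cong:
  assumes "\<And>x. x \<in> {1..n} \<Longrightarrow> f x = g x"
  shows "labelling \<sigma> n f \<phi> \<longleftrightarrow> labelling \<sigma> n g \<phi>"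
  unfolding labelling_def by (intro conj_cong ball_cong refl) (simp only: assms)

lemma segmentation_imp_labelling:
  assumes seg: "segmentation \<sigma> \<tau> e"
  shows "\<exists>\<phi>. labelling \<sigma> (length \<tau>) (entry \<tau>) \<phi>"
proof -
  let ?n = "length \<tau>" and ?k = "length \<sigma>"
  have e: "e 0 = 0" "e ?k = ?n"
    and signs: "\<And>t. t < ?k \<Longrightarrow> case \<sigma> ! t of
        Plus \<Rightarrow> strict_mono_on {e t + 1..e (Suc t)} (entry \<tau>)
      | Minus \<Rightarrow> strict_antimono_on {e t + 1..e (Suc t)} (entry \<tau>)"
    using seg unfolding segmentation_def by blast+
  \<comment> \<open>Segments may be empty; the least index picks the one whose interval really
    contains \<open>x\<close>.\<close>
  define \<phi> where "\<phi> x = (LEAST t. x \<le> e (Suc t))" for x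
  have ex: "\<exists>t<?k. x \<le> e (Suc t)" if "x \<in> {1..?n}" for x
  proof (cases ?k)
    case 0
    then show ?thesis using that e by auto
  next
    case (Suc t)
    then show ?thesis using that e by (intro exI[of _ t]) auto
  qed
  have upper: "x \<le> e (Suc (\<phi> x))" if "x \<in> {1..?n}" for x
    using ex[OF that] unfolding \<phi>_def by (metis LeastI)
  have lower: "e (\<phi> x) < x" if "x \<in> {1..?n}" for x
  proof (cases "\<phi> x")
    case 0
    then show ?thesis using that e by simp
  next
    case (Suc m)
    then have "\<not> x \<le> e (Suc m)"
      unfolding \<phi>_def by (metis lessI not_less_Least)
    then show ?thesis using Suc by simp
  qed
  have less: "\<phi> x < ?k" if "x \<in> {1..?n}" for x
    using ex[OF that] unfolding \<phi>_def by (metis Least_le le_less_trans)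
  have mono: "\<phi> x \<le> \<phi> y" if "x \<in> {1..?n}" "y \<in> {1..?n}" "x < y" for x y
  proof -
    have "x \<le> e (Suc (\<phi> y))" using upper[OF that(2)] that(3) by simp
    then show ?thesis unfolding \<phi>_def[of x] by (rule Least_le)
  qed
  have sign: "entry \<tau> x < entry \<tau> y \<longleftrightarrow> \<phi> x \<notin> neg_letters \<sigma>"
    if "x \<in> {1..?n}" "y \<in> {1..?n}" "x < y" "\<phi> x = \<phi> y" for x y
  proof -
    have in_seg: "x \<in> {e (\<phi> x) + 1..e (Suc (\<phi> x))}" "y \<in> {e (\<phi> x) + 1..e (Suc (\<phi> x))}"
      using upper[of x] lower[of x] upper[of y] lower[of y] that by auto
    show ?thesis
    proof (cases "\<sigma> ! \<phi> x")
      case Plus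
      then have "strict_mono_on {e (\<phi> x) + 1..e (Suc (\<phi> x))} (entry \<tau>)"
        using signs[OF less[OF that(1)]] by simp
      then have "entry \<tau> x < entry \<tau> y" using in_seg that(3) by (rule strict_mono_onD)
      then show ?thesis using Plus by (simp add: neg_letters_def)
    next
      case Minus
      then have "strict_antimono_on {e (\<phi> x) + 1..e (Suc (\<phi> x))} (entry \<tau>)"
        using signs[OF less[OF that(1)]] by simp
      then have "entry \<tau> y < entry \<tau> x" using in_seg that(3) by (rule monotone_onD)
      then show ?thesis using Minus less[OF that(1)] by (simp add: neg_letters_def)
    qed
  qed
  show ?thesis
    unfolding labelling_def using less mono sign by blast
qed

lemma down_closed_eq_interval:
  fixes A :: "nat set"
  assumes "A \<subseteq> {1..n}" and "\<And>x y. y \<in> A \<Longrightarrow> 1 \<le> x \<Longrightarrow> x \<le> y \<Longrightarrow> x \<in> A"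
  shows "A = {1..card A}"
proof (cases "A = {}")
  case False
  have fin: "finite A" using assms(1) finite_subset by blast
  have "A = {1..Max A}"
  proof
    show "A \<subseteq> {1..Max A}" using assms(1) fin by auto
    show "{1..Max A} \<subseteq> A" using assms(2)[OF Max_in[OF fin False]] by auto
  qed
  then show ?thesis by (metis card_atLeastAtMost diff_Suc_1)
qed simp

lemma labelling_imp_segmentation:
  assumes lab: "labelling \<sigma> (length \<tau>) (entry \<tau>) \<phi>" and inj: "inj_on (entry \<tau>) {1..length \<tau>}"
  shows "\<exists>e. segmentation \<sigma> \<tau> e"
proof -
  let ?n = "length \<tau>" and ?k = "length \<sigma>"
  \<comment> \<open>Monotonicity of \<open>\<phi>\<close> makes the counted positions an initial
    interval, so the count is also the last position with label below \<open>t\<close>.\<close>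
  define e where "e t = card {x \<in> {1..?n}. \<phi> x < t}" for t
  have e: "{x \<in> {1..?n}. \<phi> x < t} = {1..e t}" for t
    unfolding e_def
  proof (rule down_closed_eq_interval)
    fix x y assume "y \<in> {x \<in> {1..?n}. \<phi> x < t}" "1 \<le> x" "x \<le> y"
    then show "x \<in> {x \<in> {1..?n}. \<phi> x < t}"
      using labelling_mono[OF lab, of x y] by auto
  qed blast
  have in_seg: "x \<in> {1..?n} \<and> \<phi> x = t" if "x \<in> {e t + 1..e (Suc t)}" for x t
  proof -
    have "x \<in> {1..e (Suc t)}" "x \<notin> {1..e t}" using that by auto
    then show ?thesis unfolding e[symmetric] by auto
  qed
  have "e 0 = 0" by (simp add: e_def)
  moreover have "e ?k = ?n"
  proof -
    have "{x \<in> {1..?n}. \<phi> x < ?k} = {1..?n}" using labelling_less[OF lab] by auto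
    then show ?thesis by (simp add: e_def)
  qed
  moreover have "e t \<le> e (Suc t)" for t
    unfolding e_def by (rule card_mono) auto
  moreover have "case \<sigma> ! t of
        Plus \<Rightarrow> strict_mono_on {e t + 1..e (Suc t)} (entry \<tau>)
      | Minus \<Rightarrow> strict_antimono_on {e t + 1..e (Suc t)} (entry \<tau>)" if t: "t < ?k" for t
  proof (cases "\<sigma> ! t")
    case Plus
    then have "t \<notin> neg_letters \<sigma>" by (simp add: neg_letters_def)
    then have "strict_mono_on {e t + 1..e (Suc t)} (entry \<tau>)"
      by (intro strict_mono_onI) (metis in_seg labelling_sign[OF lab])
    then show ?thesis using Plus by simp
  next
    case Minus
    then have "t \<in> neg_letters \<sigma>" using t by (simp add: neg_letters_def)
    have "strict_antimono_on {e t + 1..e (Suc t)} (entry \<tau>)"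
    proof (rule monotone_onI)
      fix x y assume xy: "x \<in> {e t + 1..e (Suc t)}" "y \<in> {e t + 1..e (Suc t)}" "x < y"
      \<comment> \<open>A negative label only says that the values do not increase; injectivity
        turns this into a strict decrease.\<close>
      then have "\<not> entry \<tau> x < entry \<tau> y"
        using in_seg labelling_sign[OF lab] \<open>t \<in> neg_letters \<sigma>\<close> by metis
      moreover have "entry \<tau> x \<noteq> entry \<tau> y"
        using in_seg[OF xy(1)] in_seg[OF xy(2)] xy(3) inj by (metis inj_onD less_irrefl)
      ultimately show "entry \<tau> y < entry \<tau> x" by simp
    qed
    then show ?thesis using Minus by simp
  qed
  ultimately show ?thesis unfolding segmentation_def by blast
qed

section \<open>Moving a segment boundary\<close>

lemma labelling_relabel:
  assumes lab: "labelling \<sigma> n f \<phi>" and "p \<in> {1..n}" and "u < length \<sigma>"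
    and "\<And>x. x \<in> {1..n} \<Longrightarrow> x < p \<Longrightarrow> \<phi> x \<le> u"
    and "\<And>x. x \<in> {1..n} \<Longrightarrow> p < x \<Longrightarrow> u \<le> \<phi> x"
    and "\<And>x. x \<in> {1..n} \<Longrightarrow> x < p \<Longrightarrow> \<phi> x = u \<Longrightarrow> f x < f p \<longleftrightarrow> u \<notin> neg_letters \<sigma>"
    and "\<And>x. x \<in> {1..n} \<Longrightarrow> p < x \<Longrightarrow> \<phi> x = u \<Longrightarrow> f p < f x \<longleftrightarrow> u \<notin> neg_letters \<sigma>"
  shows "labelling \<sigma> n f (\<phi>(p := u))"
  unfolding labelling_def
proof (intro conjI ballI impI)
  \<comment> \<open>Pairs that avoid \<open>p\<close> inherit their conditions from
    \<open>lab\<close>; the hypotheses cover the pairs in which \<open>p\<close> takes part.\<close>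
  fix x y assume xy: "x \<in> {1..n}" "y \<in> {1..n}" "x < y"
  show "(\<phi>(p := u)) x \<le> (\<phi>(p := u)) y"
    using xy assms(4,5) labelling_mono[OF lab xy(1,2)] by (cases "x = p"; cases "y = p") auto
  assume "(\<phi>(p := u)) x = (\<phi>(p := u)) y"
  then show "f x < f y \<longleftrightarrow> (\<phi>(p := u)) x \<notin> neg_letters \<sigma>"
    using xy assms(6)[of x] assms(7)[of y] labelling_sign[OF lab xy]
    by (cases "x = p"; cases "y = p") auto
next
  fix x assume "x \<in> {1..n}"
  then show "(\<phi>(p := u)) x < length \<sigma>"
    using labelling_less[OF lab] assms(3) by auto
qed

text \<open>As the two neighbours carry opposite signs, the comparison of \<open>f p\<close> with
  \<open>f (Suc p)\<close> fits exactly one of the two labels. If it fits the right one,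
  \<open>p\<close> can join the right block; otherwise \<open>Suc p\<close> can join the left
  one.\<close>

lemma relabel_at_boundary:
  assumes lab: "labelling \<sigma> n f \<phi>" and inj: "inj_on f {1..n}"
    and p: "p \<in> {1..n}" "Suc p \<in> {1..n}"
    and opp: "\<phi> p \<in> neg_letters \<sigma> \<longleftrightarrow> \<phi> (Suc p) \<notin> neg_letters \<sigma>"
  shows "\<exists>q\<in>{1..n}. \<exists>u. u \<noteq> \<phi> q \<and> labelling \<sigma> n f (\<phi>(q := u))"
proof -
  have ne: "\<phi> p \<noteq> \<phi> (Suc p)" using opp by auto
  have le: "\<phi> p \<le> \<phi> (Suc p)" by (rule labelling_mono[OF lab p]) simp
  have f_ne: "f x \<noteq> f y" if "x \<in> {1..n}" "y \<in> {1..n}" "x < y" for x y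
    using that inj by (auto dest: inj_onD)
  show ?thesis
  proof (cases "f p < f (Suc p) \<longleftrightarrow> \<phi> (Suc p) \<notin> neg_letters \<sigma>")
    case True
    have "labelling \<sigma> n f (\<phi>(p := \<phi> (Suc p)))"
    proof (rule labelling_relabel[OF lab p(1) labelling_less[OF lab p(2)]])
      fix x assume x: "x \<in> {1..n}"
      show "\<phi> x \<le> \<phi> (Suc p)" if "x < p" using labelling_mono[OF lab x p(2)] that by simp
      show "\<phi> (Suc p) \<le> \<phi> x" if "p < x" using labelling_mono[OF lab p(2) x] that by simp
      show "f x < f p \<longleftrightarrow> \<phi> (Suc p) \<notin> neg_letters \<sigma>" if "x < p" "\<phi> x = \<phi> (Suc p)"
        using labelling_mono[OF lab x p(1)] that le ne by simp
      show "f p < f x \<longleftrightarrow> \<phi> (Suc p) \<notin> neg_letters \<sigma>" if "p < x" "\<phi> x = \<phi> (Suc p)"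
      proof (cases "x = Suc p")
        case False
        \<comment> \<open>From \<open>f p\<close> to \<open>f (Suc p)\<close> and on to
          \<open>f x\<close> the values move in the same direction, so the comparison follows by
          transitivity.\<close>
        then have "Suc p < x" using that by simp
        then show ?thesis
          using labelling_sign[OF lab p(2) x] that f_ne[OF p] f_ne[OF p(2) x] True by auto
      qed (use True in simp)
    qed
    then show ?thesis using p(1) ne by metis
  next
    case False
    then have p_less: "f p < f (Suc p) \<longleftrightarrow> \<phi> p \<notin> neg_letters \<sigma>" using opp by blast
    have "labelling \<sigma> n f (\<phi>(Suc p := \<phi> p))"
    proof (rule labelling_relabel[OF lab p(2) labelling_less[OF lab p(1)]])
      fix x assume x: "x \<in> {1..n}"
      show "\<phi> x \<le> \<phi> p" if "x < Suc p" using labelling_mono[OF lab x p(1)] that by simp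
      show "\<phi> p \<le> \<phi> x" if "Suc p < x" using labelling_mono[OF lab p(1) x] that by simp
      show "f (Suc p) < f x \<longleftrightarrow> \<phi> p \<notin> neg_letters \<sigma>" if "Suc p < x" "\<phi> x = \<phi> p"
        using labelling_mono[OF lab p(2) x] that le ne by simp
      show "f x < f (Suc p) \<longleftrightarrow> \<phi> p \<notin> neg_letters \<sigma>" if "x < Suc p" "\<phi> x = \<phi> p"
      proof (cases "x = p")
        case False
        then have "x < p" using that by simp
        then show ?thesis
          using labelling_sign[OF lab x p(1)] that f_ne[OF p] f_ne[OF x p(1)] p_less by auto
      qed (use p_less in simp)
    qed
    then show ?thesis using p(2) ne by metis
  qed
qed

text \<open>
  Among all pairs of a used label and a letter of opposite sign, take a closest one: no used label
  lies strictly between them, so a point at the end of a block may be moved across.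
\<close>

lemma ex_relabel:
  assumes lab: "labelling \<sigma> n f \<phi>" and inj: "inj_on f {1..n}" and "1 \<le> n"
    and a: "a < length \<sigma>" "a \<in> neg_letters \<sigma>" and b: "b < length \<sigma>" "b \<notin> neg_letters \<sigma>"
  shows "\<exists>q\<in>{1..n}. \<exists>u. u \<noteq> \<phi> q \<and> labelling \<sigma> n f (\<phi>(q := u))"
proof -
  define P where "P = (\<lambda>(p, u). p \<in> {1..n} \<and> u < length \<sigma> \<and>
    (\<phi> p \<in> neg_letters \<sigma> \<longleftrightarrow> u \<notin> neg_letters \<sigma>))"
  \<comment> \<open>With truncated subtraction this is the absolute difference.\<close>
  define D where "D = (\<lambda>(p, u). (\<phi> p - u) + (u - \<phi> p))"
  \<comment> \<open>The label of position 1 has some sign, and one of \<open>a\<close> and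
    \<open>b\<close> has the other.\<close>
  have "P (1, a) \<or> P (1, b)" using assms by (auto simp: P_def)
  then obtain z where z: "P z" "\<forall>z'. P z' \<longrightarrow> D z \<le> D z'"
    using ex_has_least_nat[of P _ D] by blast
  obtain p u where zpu: "z = (p, u)" by force
  have p: "p \<in> {1..n}" and u: "u < length \<sigma>"
    and opp: "\<phi> p \<in> neg_letters \<sigma> \<longleftrightarrow> u \<notin> neg_letters \<sigma>"
    using z(1) by (auto simp: zpu P_def)
  have ne: "u \<noteq> \<phi> p" using opp by auto
  have gap: "\<not> (\<phi> p < \<phi> y \<and> \<phi> y < u)" "\<not> (u < \<phi> y \<and> \<phi> y < \<phi> p)" if y: "y \<in> {1..n}" for y
  proof -
    \<comment> \<open>The sign of \<open>\<phi> y\<close> is opposite to that of \<open>u\<close> or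
      to that of \<open>\<phi> p\<close>, so a value strictly in between would give a closer
      pair.\<close>
    have "P (y, u) \<or> P (p, \<phi> y)"
      using y p u opp labelling_less[OF lab y] by (auto simp: P_def)
    then have "D (p, u) \<le> D (y, u) \<or> D (p, u) \<le> D (p, \<phi> y)"
      using z(2) zpu by blast
    then show "\<not> (\<phi> p < \<phi> y \<and> \<phi> y < u)" "\<not> (u < \<phi> y \<and> \<phi> y < \<phi> p)"
      by (auto simp: D_def)
  qed
  define B where "B = {x \<in> {1..n}. \<phi> x = \<phi> p}"
  have B: "finite B" "B \<noteq> {}" using p by (auto simp: B_def)
  show ?thesis
  proof (cases "\<phi> p < u")
    case True
    \<comment> \<open>Every position after the end of the block has label at least \<open>u\<close>,
      so \<open>q\<close> borders on the block of \<open>u\<close> if that is nonempty.\<close>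
    define q where "q = Max B"
    have q: "q \<in> {1..n}" "\<phi> q = \<phi> p" using Max_in[OF B] by (auto simp: B_def q_def)
    have above: "u \<le> \<phi> y" if "y \<in> {1..n}" "q < y" for y
    proof -
      have "y \<notin> B" using that(2) Max_ge[OF B(1), of y] by (auto simp: q_def)
      then have "\<phi> y \<noteq> \<phi> p" using that(1) by (simp add: B_def)
      moreover have "\<phi> p \<le> \<phi> y" using labelling_mono[OF lab q(1) that(1)] that(2) q(2) by simp
      ultimately show ?thesis using gap[OF that(1)] by linarith
    qed
    show ?thesis
    proof (cases "\<exists>y\<in>{1..n}. \<phi> y = u")
      case used: True
      then obtain y where y: "y \<in> {1..n}" "\<phi> y = u" by blast
      have "q < y" using labelling_mono[OF lab y(1) q(1)] y(2) q(2) True by (metis leD not_le_imp_less)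
      then have Sq: "Suc q \<in> {1..n}" using y by simp
      have "\<phi> (Suc q) = u"
        using labelling_mono[OF lab Sq y(1)] above[OF Sq] \<open>q < y\<close> y(2) by simp
      then show ?thesis using relabel_at_boundary[OF lab inj q(1) Sq] q(2) opp by simp
    next
      case False
      \<comment> \<open>The segment of \<open>u\<close> is empty, so \<open>q\<close> is placed in
        it alone and there are no values to compare.\<close>
      have "labelling \<sigma> n f (\<phi>(q := u))"
      proof (rule labelling_relabel[OF lab q(1) u])
        fix x assume x: "x \<in> {1..n}"
        show "\<phi> x \<le> u" if "x < q" using labelling_mono[OF lab x q(1)] that q(2) True by simp
      qed (use above False in blast)+
      then show ?thesis using q ne by metis
    qed
  next
    case False
    then have less: "u < \<phi> p" using ne by simp
    \<comment> \<open>The mirror image: the block is left at its first position.\<close>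
    define q where "q = Min B"
    have q: "q \<in> {1..n}" "\<phi> q = \<phi> p" using Min_in[OF B] by (auto simp: B_def q_def)
    have below: "\<phi> y \<le> u" if "y \<in> {1..n}" "y < q" for y
    proof -
      have "y \<notin> B" using that(2) Min_le[OF B(1), of y] by (auto simp: q_def)
      then have "\<phi> y \<noteq> \<phi> p" using that(1) by (simp add: B_def)
      moreover have "\<phi> y \<le> \<phi> p" using labelling_mono[OF lab that(1) q(1)] that(2) q(2) by simp
      ultimately show ?thesis using gap[OF that(1)] by linarith
    qed
    show ?thesis
    proof (cases "\<exists>y\<in>{1..n}. \<phi> y = u")
      case True
      then obtain y where y: "y \<in> {1..n}" "\<phi> y = u" by blast
      have "y < q" using labelling_mono[OF lab q(1) y(1)] y(2) q(2) less by (metis leD not_le_imp_less)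
      then obtain r where r: "q = Suc r" by (cases q) auto
      have r': "r \<in> {1..n}" "y \<le> r" "Suc r \<in> {1..n}" using y(1) \<open>y < q\<close> q(1) r by auto
      have "\<phi> r = u"
        using labelling_mono[OF lab y(1) r'(1,2)] below[OF r'(1)] y(2) r by simp
      then show ?thesis using relabel_at_boundary[OF lab inj r'(1,3)] q(2) opp r by simp
    next
      case False
      have "labelling \<sigma> n f (\<phi>(q := u))"
      proof (rule labelling_relabel[OF lab q(1) u])
        fix x assume x: "x \<in> {1..n}"
        show "u \<le> \<phi> x" if "q < x" using labelling_mono[OF lab q(1) x] that q(2) less by simp
      qed (use below False in blast)+
      then show ?thesis using q ne by metis
    qed
  qed
qed

section \<open>Itineraries\<close>

definition itinerary :: "('a \<Rightarrow> 'a) \<Rightarrow> ('a \<Rightarrow> 'b) \<Rightarrow> 'a \<Rightarrow> 'b stream" where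
  "itinerary f \<phi> x = smap \<phi> (siterate f x)"

lemma itinerary_simps [simp]:
  "shd (itinerary f \<phi> x) = \<phi> x"
  "stl (itinerary f \<phi> x) = itinerary f \<phi> (f x)"
  "itinerary f \<phi> x !! i = \<phi> ((f ^^ i) x)"
  "sdrop i (itinerary f \<phi> x) = itinerary f \<phi> ((f ^^ i) x)"
  by (simp_all add: itinerary_def)

text \<open>At equal heads a negative label reverses the order of the tails, while \<open>f\<close>
  reverses the order on that segment; the two reversals cancel. For this the induction hypothesis is
  used with \<open>f x\<close> and \<open>f y\<close> in both orders.\<close>

lemma itinerary_less_imp_less:
  assumes lab: "labelling \<sigma> n f \<phi>" and f: "\<And>x. x \<in> {1..n} \<Longrightarrow> f x \<in> {1..n}"
    and "x \<in> {1..n}" and "y \<in> {1..n}"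
    and "word_less \<sigma> (itinerary f \<phi> x) (itinerary f \<phi> y)"
  shows "x < y"
proof -
  have "itinerary f \<phi> x \<noteq> itinerary f \<phi> y" using assms(5) by auto
  then obtain j where "itinerary f \<phi> x !! j \<noteq> itinerary f \<phi> y !! j"
    by (rule first_difference) blast
  then show ?thesis using assms(3-5)
  proof (induction j arbitrary: x y)
    case 0
    then have "\<phi> x < \<phi> y" using word_less_unfold[of \<sigma> "itinerary f \<phi> x"] by auto
    then show ?case
      using labelling_mono[OF lab 0(3,2)] by (meson leD not_le_imp_less)
  next
    case (Suc j)
    show ?case
    proof (cases "\<phi> x = \<phi> y")
      case False
      then have "\<phi> x < \<phi> y"
        using Suc.prems(4) word_less_unfold[of \<sigma> "itinerary f \<phi> x"] by auto
      then show ?thesis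
        using labelling_mono[OF lab Suc.prems(3,2)] by (meson leD not_le_imp_less)
    next
      case True
      note fx = f[OF Suc.prems(2)] and fy = f[OF Suc.prems(3)]
      have diff: "itinerary f \<phi> (f x) !! j \<noteq> itinerary f \<phi> (f y) !! j"
        using Suc.prems(1) by (simp add: funpow_swap1)
      have *: "if \<phi> x \<in> neg_letters \<sigma> then f y < f x else f x < f y"
        using Suc.prems(4) True Suc.IH[OF diff fx fy] Suc.IH[OF diff[symmetric] fy fx]
          word_less_unfold[of \<sigma> "itinerary f \<phi> x"] by auto
      then have "x \<noteq> y" by auto
      moreover have "\<not> y < x"
        using labelling_sign[OF lab Suc.prems(3,2)] * True by (auto split: if_splits)
      ultimately show ?thesis by simp
    qed
  qed
qed

text \<open>Points with the same itinerary share a segment at each step, so on them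
  \<open>f ^^ d\<close> is a composition of monotone maps. The witness for \<open>b\<close> records
  whether the first \<open>d\<close> letters of \<open>w\<close> contain an even number of negative
  ones.\<close>

lemma funpow_monotone_on_fibre:
  assumes lab: "labelling \<sigma> n f \<phi>" and f: "\<And>x. x \<in> {1..n} \<Longrightarrow> f x \<in> {1..n}"
    and inj: "inj_on f {1..n}"
  shows "\<exists>b. (neg_letters \<sigma> = {} \<longrightarrow> b) \<and> (\<forall>x\<in>{1..n}. \<forall>y\<in>{1..n}.
    itinerary f \<phi> x = w \<longrightarrow> itinerary f \<phi> y = w \<longrightarrow> x < y \<longrightarrow>
    (if b then (f ^^ d) x < (f ^^ d) y else (f ^^ d) y < (f ^^ d) x))"
proof (induction d arbitrary: w)
  case 0
  show ?case by (intro exI[of _ True]) simp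
next
  case (Suc d)
  obtain b where pos: "neg_letters \<sigma> = {} \<Longrightarrow> b"
    and b: "\<And>x y. x \<in> {1..n} \<Longrightarrow> y \<in> {1..n} \<Longrightarrow> itinerary f \<phi> x = stl w \<Longrightarrow>
      itinerary f \<phi> y = stl w \<Longrightarrow> x < y \<Longrightarrow>
      if b then (f ^^ d) x < (f ^^ d) y else (f ^^ d) y < (f ^^ d) x"
    using Suc[of "stl w"] by blast
  show ?case
  proof (intro exI[of _ "b \<longleftrightarrow> shd w \<notin> neg_letters \<sigma>"] conjI ballI impI)
    fix x y assume x: "x \<in> {1..n}" and y: "y \<in> {1..n}"
      and wx: "itinerary f \<phi> x = w" and wy: "itinerary f \<phi> y = w" and "x < y"
    have heads: "\<phi> x = shd w" "\<phi> y = shd w"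
      and tails: "itinerary f \<phi> (f x) = stl w" "itinerary f \<phi> (f y) = stl w"
      using wx wy itinerary_simps(1,2) by metis+
    have ne: "f x \<noteq> f y" using inj x y \<open>x < y\<close> by (metis inj_onD less_irrefl)
    have "f x < f y \<longleftrightarrow> shd w \<notin> neg_letters \<sigma>"
      using labelling_sign[OF lab x y \<open>x < y\<close>] heads by simp
    then show "if b \<longleftrightarrow> shd w \<notin> neg_letters \<sigma> then (f ^^ Suc d) x < (f ^^ Suc d) y
        else (f ^^ Suc d) y < (f ^^ Suc d) x"
      using b[OF f[OF x] f[OF y] tails] b[OF f[OF y] f[OF x] tails(2,1)] ne
      by (cases "f x < f y") (auto simp: funpow_Suc_right simp del: funpow.simps split: if_splits)
  qed (use pos in simp)
qed

text \<open>If \<open>g\<close> moved \<open>x\<close> up, iteration would push it ever higher, and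
  likewise downwards; either way it could not return.\<close>

lemma strict_mono_periodic_point_fixed:
  fixes g :: "'a::linorder \<Rightarrow> 'a"
  assumes "\<And>x y. x \<in> C \<Longrightarrow> y \<in> C \<Longrightarrow> x < y \<Longrightarrow> g x < g y"
    and g: "\<And>x. x \<in> C \<Longrightarrow> g x \<in> C" and "x \<in> C" and "(g ^^ m) x = x" and "0 < m"
  shows "g x = x"
proof -
  have C: "(g ^^ i) x \<in> C" for i by (induction i) (use assms in auto)
  obtain l where m: "m = Suc l" using assms(5) by (cases m) auto
  have up: "x < (g ^^ Suc i) x" if "x < g x" for i
  proof -
    have step: "(g ^^ i) x < (g ^^ Suc i) x" for i
    proof (induction i)
      case (Suc i)
      then show ?case using assms(1)[OF C[of i] C[of "Suc i"]] by simp
    qed (use that in simp)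
    show ?thesis
    proof (induction i)
      case (Suc i)
      then show ?case using step[of "Suc i"] by (rule less_trans)
    qed (use that in simp)
  qed
  have down: "(g ^^ Suc i) x < x" if "g x < x" for i
  proof -
    have step: "(g ^^ Suc i) x < (g ^^ i) x" for i
    proof (induction i)
      case (Suc i)
      then show ?case using assms(1)[OF C[of "Suc i"] C[of i]] by simp
    qed (use that in simp)
    show ?thesis
    proof (induction i)
      case (Suc i)
      show ?case using step[of "Suc i"] Suc by (rule less_trans)
    qed (use that in simp)
  qed
  show ?thesis
    using up[of l] down[of l] assms(4) m by (metis less_irrefl linorder_neqE)
qed

section \<open>Collisions of itineraries under a cyclic map\<close>

locale cyclic_map =
  fixes n :: nat and f :: "nat \<Rightarrow> nat"
  assumes f_in: "x \<in> {1..n} \<Longrightarrow> f x \<in> {1..n}"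
    and inj_f: "inj_on f {1..n}"
    and reach: "x \<in> {1..n} \<Longrightarrow> y \<in> {1..n} \<Longrightarrow> \<exists>d<n. (f ^^ d) x = y"
    and funpow_eq_iff: "x \<in> {1..n} \<Longrightarrow> (f ^^ d) x = x \<longleftrightarrow> n dvd d"
begin

lemma funpow_in: "x \<in> {1..n} \<Longrightarrow> (f ^^ d) x \<in> {1..n}"
  by (induction d) (simp_all add: f_in del: One_nat_def atLeastAtMost_iff)

lemma itinerary_collision:
  assumes lab: "labelling \<sigma> n f \<phi>" and x: "x \<in> {1..n}" and "y \<in> {1..n}" and "x \<noteq> y"
    and eq: "itinerary f \<phi> x = itinerary f \<phi> y"
  shows "even n" and "neg_letters \<sigma> \<noteq> {}" and "z \<in> {1..n} \<Longrightarrow> \<phi> ((f ^^ (n div 2)) z) = \<phi> z"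
proof -
  obtain d where d: "d < n" "(f ^^ d) x = y" using reach[OF x assms(3)] by blast
  with assms(4) have "0 < d" by (cases d) auto
  \<comment> \<open>\<open>f ^^ d\<close> commutes with the iterates of \<open>f\<close>, so the
    collision at \<open>x\<close> travels along the orbit, which is all of
    \<open>{1..n}\<close>.\<close>
  have shift: "itinerary f \<phi> ((f ^^ d) z) = itinerary f \<phi> z" if z: "z \<in> {1..n}" for z
  proof -
    obtain i where i: "(f ^^ i) x = z" using reach[OF x z] by blast
    have "(f ^^ d) z = (f ^^ i) y"
      unfolding i[symmetric] d(2)[symmetric] by (metis add.commute funpow_add o_apply)
    then have "itinerary f \<phi> ((f ^^ d) z) = sdrop i (itinerary f \<phi> y)" by simp
    also have "\<dots> = itinerary f \<phi> z" unfolding eq[symmetric] using i by simp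
    finally show ?thesis .
  qed
  define g where "g = f ^^ d"
  define C where "C = {z \<in> {1..n}. itinerary f \<phi> z = itinerary f \<phi> x}"
  have gC: "g z \<in> C" if "z \<in> C" for z
    using that shift funpow_in unfolding C_def g_def by simp
  have xC: "x \<in> C" using x by (simp add: C_def)
  have g_fixed: "(g ^^ n) x = x"
    unfolding g_def funpow_mult using funpow_eq_iff[OF x] by simp
  have "0 < n" using d(1) by simp
  have gx: "g x \<noteq> x" using d(2) assms(4) by (simp add: g_def)
  obtain b where pos: "neg_letters \<sigma> = {} \<Longrightarrow> b"
    and b: "\<And>u v. u \<in> C \<Longrightarrow> v \<in> C \<Longrightarrow> u < v \<Longrightarrow> if b then g u < g v else g v < g u"
    using funpow_monotone_on_fibre[OF lab f_in inj_f, of "itinerary f \<phi> x" d]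
    unfolding C_def g_def by blast
  have "\<not> b"
  proof
    assume b_true: b
    have "g x = x"
      by (rule strict_mono_periodic_point_fixed[of C g x n])
        (use b b_true gC xC g_fixed \<open>0 < n\<close> in auto)
    with gx show False by simp
  qed
  then show "neg_letters \<sigma> \<noteq> {}" using pos by blast
  have "(g \<circ> g) x = x"
  proof (rule strict_mono_periodic_point_fixed[of C "g \<circ> g" x n])
    show "(g \<circ> g) u < (g \<circ> g) v" if "u \<in> C" "v \<in> C" "u < v" for u v
      using b[OF that] b[OF gC[OF that(2)] gC[OF that(1)]] \<open>\<not> b\<close> by simp
    have "g \<circ> g = g ^^ 2" by (simp add: numeral_2_eq_2)
    then have "((g \<circ> g) ^^ n) x = (g ^^ (n * 2)) x" by (simp add: funpow_mult mult.commute)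
    also have "\<dots> = ((g ^^ n) ^^ 2) x" by (simp only: funpow_mult)
    finally show "((g \<circ> g) ^^ n) x = x" using g_fixed by (simp add: numeral_2_eq_2)
  qed (use gC xC \<open>0 < n\<close> in auto)
  then have "(f ^^ (d + d)) x = x" by (simp add: g_def funpow_add)
  then have "n dvd d + d" using funpow_eq_iff[OF x] by blast
  then obtain c where c: "d + d = n * c" by (rule dvdE)
  \<comment> \<open>As \<open>0 < d\<close> and \<open>d < n\<close>, the multiple
    \<open>d + d\<close> of \<open>n\<close> lies strictly between 0 and
    \<open>2 * n\<close>.\<close>
  have "c = 1"
  proof (rule ccontr)
    assume "c \<noteq> 1"
    then consider "c = 0" | "2 \<le> c" by linarith
    then show False
    proof cases
      case 2
      then have "n * 2 \<le> d + d" unfolding c by (intro mult_le_mono2)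
      then show False using d(1) by simp
    qed (use c \<open>0 < d\<close> in simp)
  qed
  then have n: "n = d + d" using c by simp
  then show "even n" by simp
  have "n div 2 = d" using n by simp
  then show "\<phi> ((f ^^ (n div 2)) z) = \<phi> z" if "z \<in> {1..n}"
    using shift[OF that] itinerary_simps(1) by metis
qed

text \<open>
  A labelling whose itineraries collide is invariant under the fixed-point-free half turn
  \<open>f ^^ (n div 2)\<close>; changing it at a single point destroys this invariance.
\<close>

lemma ex_labelling_inj_itinerary:
  assumes lab: "labelling \<sigma> n f \<phi>" and n: "1 \<le> n"
    and b: "b < length \<sigma>" "b \<notin> neg_letters \<sigma>"
  shows "\<exists>\<psi>. labelling \<sigma> n f \<psi> \<and> inj_on (itinerary f \<psi>) {1..n}"
proof (rule ccontr)
  assume contra: "\<nexists>\<psi>. labelling \<sigma> n f \<psi> \<and> inj_on (itinerary f \<psi>) {1..n}"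
  \<comment> \<open>Under the assumption to be refuted every labelling collides, so this applies to
    the given labelling and to the modified one alike.\<close>
  have collision: "even n" "neg_letters \<sigma> \<noteq> {}" "\<forall>z\<in>{1..n}. \<psi> ((f ^^ (n div 2)) z) = \<psi> z" if lab': "labelling \<sigma> n f \<psi>" for \<psi>
  proof -
    obtain x y where "x \<in> {1..n}" "y \<in> {1..n}" "x \<noteq> y" "itinerary f \<psi> x = itinerary f \<psi> y"
      using contra lab' unfolding inj_on_def by blast
    from itinerary_collision[OF lab' this]
    show "even n" "neg_letters \<sigma> \<noteq> {}" "\<forall>z\<in>{1..n}. \<psi> ((f ^^ (n div 2)) z) = \<psi> z" by blast+
  qed
  obtain a where a: "a < length \<sigma>" "a \<in> neg_letters \<sigma>"
    using collision(2)[OF lab] by (auto simp: neg_letters_def)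
  obtain q u where q: "q \<in> {1..n}" and u: "u \<noteq> \<phi> q" "labelling \<sigma> n f (\<phi>(q := u))"
    using ex_relabel[OF lab inj_f n a b] by blast
  let ?h = "(f ^^ (n div 2)) q"
  \<comment> \<open>\<open>n div 2\<close> is positive and below \<open>n\<close>, so the half turn
    moves \<open>q\<close>, and the update at \<open>q\<close> leaves the label of its image
    alone.\<close>
  have "\<not> n dvd n div 2" using n collision(1)[OF lab] by (auto dest!: dvd_imp_le)
  then have "?h \<noteq> q" using funpow_eq_iff[OF q] by blast
  then have "\<phi> ?h = u" using collision(3)[OF u(2)] q by (metis fun_upd_apply)
  moreover have "\<phi> ?h = \<phi> q" using collision(3)[OF lab] q by blast
  ultimately show False using u(1) by simp
qed

end

section \<open>Patterns and cyclic permutations\<close>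

lemma funpow_cycle_of_list:
  assumes "distinct \<pi>" and "j < length \<pi>"
  shows "(cycle_of_list \<pi> ^^ i) (\<pi> ! j) = \<pi> ! ((i + j) mod length \<pi>)"
proof -
  have "(cycle_of_list \<pi> ^^ i) (\<pi> ! j) = map (cycle_of_list \<pi> ^^ i) \<pi> ! j"
    using assms(2) by simp
  also have "\<dots> = rotate i \<pi> ! j" by (simp add: cyclic_rotation[OF assms(1)])
  finally show ?thesis using assms(2) by (simp add: nth_rotate)
qed

lemma in_perm_iff:
  "\<pi> \<in> perms n \<Longrightarrow> x \<in> {1..n} \<longleftrightarrow> (\<exists>i<n. x = \<pi> ! i)"
  unfolding perms_iff by (metis in_set_conv_nth)

lemma cyclic_map_cycle_of_list:
  assumes "\<pi> \<in> perms n"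
  shows "cyclic_map n (cycle_of_list \<pi>)"
proof
  let ?f = "cycle_of_list \<pi>"
  have \<pi>: "length \<pi> = n" "distinct \<pi>" "set \<pi> = {1..n}" using assms unfolding perms_iff by auto
  note pow = funpow_cycle_of_list[OF \<pi>(2), unfolded \<pi>(1)]
  have perm: "?f permutes {1..n}" using cycle_permutes[of \<pi>] \<pi>(3) by simp
  show "?f x \<in> {1..n}" if "x \<in> {1..n}" for x
    using permutes_in_image[OF perm] that by blast
  show "inj_on ?f {1..n}" using perm by (rule permutes_inj_on)
  fix x assume "x \<in> {1..n}"
  then obtain i where i: "i < n" "x = \<pi> ! i" using in_perm_iff[OF assms] by blast
  show "(?f ^^ d) x = x \<longleftrightarrow> n dvd d" for d
  proof -
    have "(?f ^^ d) x = x \<longleftrightarrow> (d + i) mod n = i"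
      using i pow[OF i(1), of d] \<pi> by (simp add: nth_eq_iff_index_eq)
    also have "\<dots> \<longleftrightarrow> (i + d) mod n = i mod n" using i(1) by (simp add: add.commute)
    also have "\<dots> \<longleftrightarrow> n dvd d"
      using mod_eq_dvd_iff_nat[of i "i + d" n] by auto
    finally show ?thesis .
  qed
  fix y assume "y \<in> {1..n}"
  then obtain j where j: "j < n" "y = \<pi> ! j" using in_perm_iff[OF assms] by blast
  \<comment> \<open>Adding \<open>n\<close> keeps the difference from being truncated; the exponent
    is reduced modulo \<open>n\<close> afterwards.\<close>
  have "(j + n - i + i) mod n = j" using i(1) j(1) by simp
  then have "(?f ^^ (j + n - i)) x = y" using pow[OF i(1)] i(2) j(2) by simp
  moreover have "(?f ^^ (j + n - i)) x = (?f ^^ ((j + n - i) mod n)) x"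
    unfolding i(2) pow[OF i(1)] by (simp add: mod_add_left_eq)
  ultimately show "\<exists>d<n. (?f ^^ d) x = y"
    using i(1) by (intro exI[of _ "(j + n - i) mod n"]) simp
qed

lemma hat_perm:
  assumes "\<pi> \<in> perms n"
  shows length_hat: "length (hat \<pi>) = n"
    and entry_hat: "x \<in> {1..n} \<Longrightarrow> entry (hat \<pi>) x = cycle_of_list \<pi> x"
    and hat_in_perms: "hat \<pi> \<in> perms n"
proof -
  have \<pi>: "length \<pi> = n" "distinct \<pi>" "set \<pi> = {1..n}" using assms unfolding perms_iff by auto
  have perm: "cycle_of_list \<pi> permutes {1..n}" using cycle_permutes[of \<pi>] \<pi>(3) by simp
  show len: "length (hat \<pi>) = n" by (simp add: hat_def \<pi>(1))
  show "entry (hat \<pi>) x = cycle_of_list \<pi> x" if "x \<in> {1..n}"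
    using that by (auto simp: entry_def hat_def \<pi>(1) simp del: upt_Suc)
  have "set (hat \<pi>) = {1..n}"
    using permutes_image[OF perm]
    by (simp add: hat_def \<pi>(1) atLeastLessThanSuc_atLeastAtMost del: upt_Suc)
  moreover have "distinct (hat \<pi>)"
    using permutes_inj_on[OF perm] by (simp add: hat_def \<pi>(1) distinct_map del: upt_Suc)
  ultimately show "hat \<pi> \<in> perms n" unfolding perms_iff using len by blast
qed

lemma cyclic_perm_hat:
  assumes "\<pi> \<in> perms n" and "1 \<le> n"
  shows "cyclic_perm (hat \<pi>)"
proof -
  let ?f = "cycle_of_list \<pi>"
  interpret cyclic_map n ?f using assms(1) by (rule cyclic_map_cycle_of_list)
  have one: "1 \<in> {1..n}" using assms(2) by simp
  have "{1..n} = orbit ?f 1"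
  proof
    show "orbit ?f 1 \<subseteq> {1..n}" using funpow_in[OF one] by (auto simp: orbit_altdef)
    show "{1..n} \<subseteq> orbit ?f 1"
    proof
      fix y assume "y \<in> {1..n}"
      then obtain d where d: "(?f ^^ d) 1 = y" using reach[OF one] by blast
      \<comment> \<open>Elements of an \<open>orbit\<close> are reached by at least one application,
        so a full turn is added to cover \<open>d = 0\<close>.\<close>
      have "(?f ^^ (d + n)) 1 = y" using d funpow_eq_iff[OF one, of n] by (simp add: funpow_add)
      then show "y \<in> orbit ?f 1" using assms(2) by (auto simp: orbit_altdef intro!: exI[of _ "d + n"])
    qed
  qed
  then have "cyclic_on ?f {1..n}" using one unfolding cyclic_on_def by blast
  then show ?thesis
    unfolding cyclic_perm_def length_hat[OF assms(1)]
    using cyclic_cong[of "{1..n}" "entry (hat \<pi>)" ?f] entry_hat[OF assms(1)] by blast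
qed

text \<open>\<open>hat \<pi>\<close> is a cyclic permutation in any case, so only the segmentation
  carries content, and a labelling encodes it.\<close>

lemma hat_in_cyclic_segmented_perms_iff:
  assumes "\<pi> \<in> perms n" and "1 \<le> n"
  shows "hat \<pi> \<in> cyclic_segmented_perms \<sigma> \<longleftrightarrow> (\<exists>\<phi>. labelling \<sigma> n (cycle_of_list \<pi>) \<phi>)"
proof -
  have lab: "labelling \<sigma> n (entry (hat \<pi>)) \<phi> \<longleftrightarrow> labelling \<sigma> n (cycle_of_list \<pi>) \<phi>" for \<phi>
    by (rule labelling_cong) (rule entry_hat[OF assms(1)])
  have inj: "inj_on (entry (hat \<pi>)) {1..n}"
    using bij_betw_entry[OF hat_in_perms[OF assms(1)]] by (rule bij_betw_imp_inj_on)
  have "hat \<pi> \<in> cyclic_segmented_perms \<sigma> \<longleftrightarrow> (\<exists>e. segmentation \<sigma> (hat \<pi>) e)"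
    unfolding cyclic_segmented_perms_def segmented_perms_def
    using hat_in_perms[OF assms(1)] cyclic_perm_hat[OF assms] by blast
  also have "\<dots> \<longleftrightarrow> (\<exists>\<phi>. labelling \<sigma> n (entry (hat \<pi>)) \<phi>)"
    using segmentation_imp_labelling[of \<sigma> "hat \<pi>"] labelling_imp_segmentation[of \<sigma> "hat \<pi>"] inj
    unfolding length_hat[OF assms(1)] by blast
  finally show ?thesis unfolding lab .
qed

section \<open>From patterns to labellings\<close>

lemma pattern_imp_labelling:
  assumes s: "s \<in> periodic_words (length \<sigma>) n"
  defines "\<pi> \<equiv> periodic_pattern \<sigma> n s"
  shows "\<exists>\<phi>. labelling \<sigma> n (cycle_of_list \<pi>) \<phi>"
proof -
  have \<pi>_perm: "\<pi> \<in> perms n" unfolding \<pi>_def by (rule periodic_pattern(1)[OF s])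
  then have \<pi>: "length \<pi> = n" "distinct \<pi>" unfolding perms_iff by auto
  have order: "\<pi> ! i < \<pi> ! j \<longleftrightarrow> word_less \<sigma> (sdrop i s) (sdrop j s)" if "i < n" "j < n" for i j
    using periodic_pattern(2)[OF s, of "Suc i" "Suc j" \<sigma>] that by (simp add: \<pi>_def entry_def)
  obtain u where u: "length u = n" "primitive_word u" "s = Stream.cycle u"
    using s by (auto simp: periodic_words_def)
  have "sdrop n s = s" using u by (auto simp: primitive_word_def)
  then have period: "sdrop (Suc i mod n) s = sdrop (Suc i) s" if "i < n" for i
    using that by (cases "Suc i = n") auto
  have next_entry: "cycle_of_list \<pi> (\<pi> ! i) = \<pi> ! (Suc i mod n)" if "i < n" for i
    using funpow_cycle_of_list[OF \<pi>(2), of i 1] that \<pi>(1) by simp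
  have unfold: "word_less \<sigma> (sdrop i s) (sdrop j s) \<longleftrightarrow> s !! i < s !! j \<or> s !! i = s !! j \<and>
      (if s !! i \<in> neg_letters \<sigma> then word_less \<sigma> (sdrop (Suc j) s) (sdrop (Suc i) s)
       else word_less \<sigma> (sdrop (Suc i) s) (sdrop (Suc j) s))" for i j
    using word_less_unfold[of \<sigma> "sdrop i s" "sdrop j s"] by simp
  \<comment> \<open>\<open>\<pi>\<close> is distinct, so each position is the rank of one suffix and
    takes its first letter as label. As the word order sorts suffixes by head first, these labels
    increase weakly.\<close>
  define \<phi> where "\<phi> x = s !! (THE i. i < n \<and> \<pi> ! i = x)" for x
  have \<phi>: "\<phi> (\<pi> ! i) = s !! i" if "i < n" for i
  proof -
    have "(THE l. l < n \<and> \<pi> ! l = \<pi> ! i) = i"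
      by (rule the_equality) (use that \<pi> in \<open>auto simp: nth_eq_iff_index_eq\<close>)
    then show ?thesis by (simp add: \<phi>_def)
  qed
  have "labelling \<sigma> n (cycle_of_list \<pi>) \<phi>"
    unfolding labelling_def
  proof (intro conjI ballI impI)
    fix x assume "x \<in> {1..n}"
    then obtain i where i: "i < n" "x = \<pi> ! i" using in_perm_iff[OF \<pi>_perm] by blast
    have "s !! i < length \<sigma>"
      using s by (auto simp: periodic_words_def words_def streams_iff_snth)
    then show "\<phi> x < length \<sigma>" using \<phi> i by simp
  next
    fix x y assume x: "x \<in> {1..n}" and y: "y \<in> {1..n}" and "x < y"
    obtain i where i: "i < n" "x = \<pi> ! i" using x in_perm_iff[OF \<pi>_perm] by blast
    obtain j where j: "j < n" "y = \<pi> ! j" using y in_perm_iff[OF \<pi>_perm] by blast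
    have less: "word_less \<sigma> (sdrop i s) (sdrop j s)"
      using \<open>x < y\<close> order[OF i(1) j(1)] i(2) j(2) by simp
    then show "\<phi> x \<le> \<phi> y" using unfold[of i j] \<phi> i j by auto
    assume "\<phi> x = \<phi> y"
    then have eq: "s !! i = s !! j" using \<phi> i j by simp
    have mods: "Suc i mod n < n" "Suc j mod n < n" using i(1) by simp_all
    \<comment> \<open>\<open>cycle_of_list \<pi>\<close> sends the rank of a suffix to the rank of
      the next one, so the sign condition becomes the recursion of the word order.\<close>
    have image: "cycle_of_list \<pi> x < cycle_of_list \<pi> y \<longleftrightarrow>
        word_less \<sigma> (sdrop (Suc i) s) (sdrop (Suc j) s)"
      using order[OF mods] period[OF i(1)] period[OF j(1)] next_entry[OF i(1)] next_entry[OF j(1)]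
        i(2) j(2) by simp
    have asym: "\<not> word_less \<sigma> (sdrop (Suc i) s) (sdrop (Suc j) s)"
      if "word_less \<sigma> (sdrop (Suc j) s) (sdrop (Suc i) s)"
      using that word_less_linear word_less_irrefl by metis
    show "cycle_of_list \<pi> x < cycle_of_list \<pi> y \<longleftrightarrow> \<phi> x \<notin> neg_letters \<sigma>"
      using less eq asym \<phi>[OF i(1)] i(2) unfolding image unfold[of i j] by (auto split: if_splits)
  qed
  then show ?thesis by blast
qed

section \<open>From labellings to patterns\<close>

lemma eq_cycleI:
  assumes "s = u @- s" and "u \<noteq> []"
  shows "s = Stream.cycle u"
proof -
  have "s !! i = Stream.cycle u !! i" for i
  proof (induction i rule: less_induct)
    case (less i)
    have "s !! i = (u @- s) !! i" using assms(1) by simp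
    also have "\<dots> = (u @- Stream.cycle u) !! i"
    proof (cases "i < length u")
      case False
      \<comment> \<open>Nonemptiness of \<open>u\<close> makes the remaining index smaller, as the
        induction requires.\<close>
      then have "i - length u < i" using assms(2) by (cases u) auto
      then show ?thesis using less False by simp
    qed simp
    finally show ?case using cycle_decomp[OF assms(2)] by simp
  qed
  then show ?thesis by (meson first_difference)
qed

text \<open>Repeating \<open>v\<close> before forming the infinite word does not change it, so
  \<open>length v\<close> remains a period.\<close>

lemma sdrop_cycle_concat_replicate:
  assumes "v \<noteq> []" and "0 < m"
  shows "sdrop (length v) (Stream.cycle (concat (replicate m v))) = Stream.cycle (concat (replicate m v))"
proof -
  have "concat (replicate m v) @- Stream.cycle v = Stream.cycle v"
    by (induction m) (use cycle_decomp[OF assms(1)] in auto)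
  then have "Stream.cycle v = Stream.cycle (concat (replicate m v))"
    using assms by (intro eq_cycleI) auto
  then show ?thesis using sdrop_cycle_eq[OF assms(1)] by simp
qed

text \<open>Injectivity enters twice: it rules out shorter periods of the word, and it excludes ties
  between suffixes at different positions.\<close>

lemma labelling_imp_pattern:
  assumes \<pi>_perm: "\<pi> \<in> perms n" and n: "1 \<le> n"
    and lab: "labelling \<sigma> n (cycle_of_list \<pi>) \<phi>"
    and inj: "inj_on (itinerary (cycle_of_list \<pi>) \<phi>) {1..n}"
  shows "\<pi> \<in> patterns_of_length \<sigma> n"
proof -
  let ?f = "cycle_of_list \<pi>"
  interpret cyclic_map n ?f using \<pi>_perm by (rule cyclic_map_cycle_of_list)
  have \<pi>: "length \<pi> = n" "distinct \<pi>" using \<pi>_perm unfolding perms_iff by auto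
  define s where "s = itinerary ?f \<phi> (\<pi> ! 0)"
  have in_n: "\<pi> ! i \<in> {1..n}" if "i < n" for i using that in_perm_iff[OF \<pi>_perm] by blast
  have \<pi>0: "\<pi> ! 0 \<in> {1..n}" using in_n n by simp
  have pow: "(?f ^^ i) (\<pi> ! 0) = \<pi> ! i" if "i < n" for i
    using funpow_cycle_of_list[OF \<pi>(2), of 0 i] that \<pi>(1) n by simp
  have drop: "sdrop i s = itinerary ?f \<phi> (\<pi> ! i)" if "i < n" for i
    using pow[OF that] by (simp add: s_def)
  have word: "s \<in> words (length \<sigma>)"
    unfolding words_def streams_iff_snth s_def
    using labelling_less[OF lab funpow_in[OF \<pi>0]] by simp
  define u where "u = map \<phi> \<pi>"
  have len: "length u = n" and "u \<noteq> []" using \<pi>(1) n by (auto simp: u_def)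
  have "stake n s = u"
    by (rule nth_equalityI) (use \<pi>(1) pow in \<open>auto simp: s_def u_def\<close>)
  moreover have "sdrop n s = s"
    using funpow_eq_iff[OF \<pi>0, of n] by (simp add: s_def)
  ultimately have "s = u @- s" using stake_sdrop[of n s] by simp
  then have s_cycle: "s = Stream.cycle u" using \<open>u \<noteq> []\<close> by (rule eq_cycleI)
  have "primitive_word u"
    unfolding primitive_word_def
  proof (intro conjI notI)
    assume "\<exists>v m. 2 \<le> m \<and> length v < length u \<and> u = concat (replicate m v)"
    then obtain v m where v: "2 \<le> m" "length v < n" "u = concat (replicate m v)"
      using len by blast
    have "v \<noteq> []" using v(3) \<open>u \<noteq> []\<close> by auto
    then have "sdrop (length v) s = s"
      unfolding s_cycle v(3) using v(1) by (intro sdrop_cycle_concat_replicate) auto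
    then have "itinerary ?f \<phi> (\<pi> ! length v) = itinerary ?f \<phi> (\<pi> ! 0)"
      using drop[OF v(2)] by (simp add: s_def)
    then have "\<pi> ! length v = \<pi> ! 0" using inj in_n[OF v(2)] \<pi>0 by (meson inj_onD)
    then show False
      using \<pi> v(2) n \<open>v \<noteq> []\<close> by (simp add: nth_eq_iff_index_eq)
  qed (use \<open>u \<noteq> []\<close> in simp)
  then have "s \<in> periodic_words (length \<sigma>) n"
    unfolding periodic_words_def using word len s_cycle by blast
  moreover have "periodic_pattern \<sigma> n s = \<pi>"
  proof (rule periodic_pattern_eqI[OF \<pi>_perm])
    fix i j assume ij: "i \<in> {1..n}" "j \<in> {1..n}"
    then have "i - 1 < n" "j - 1 < n" by auto
    note in_i = in_n[OF this(1)] and in_j = in_n[OF this(2)] and drops = drop[OF this(1)] drop[OF this(2)]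
    \<comment> \<open>\<open>itinerary_less_imp_less\<close> gives one implication only; used in
      both orders and with ties excluded, it yields the equivalence by linearity of the word
      order.\<close>
    have "entry \<pi> i < entry \<pi> j" if "word_less \<sigma> (sdrop (i - 1) s) (sdrop (j - 1) s)"
      using itinerary_less_imp_less[OF lab f_in in_i in_j] that unfolding drops entry_def by blast
    moreover have "entry \<pi> j < entry \<pi> i" if "word_less \<sigma> (sdrop (j - 1) s) (sdrop (i - 1) s)"
      using itinerary_less_imp_less[OF lab f_in in_j in_i] that unfolding drops entry_def by blast
    moreover have "entry \<pi> i = entry \<pi> j" if "sdrop (i - 1) s = sdrop (j - 1) s"
      using that inj in_i in_j unfolding drops entry_def by (meson inj_onD)
    ultimately show "entry \<pi> i < entry \<pi> j \<longleftrightarrow>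
        word_less \<sigma> (sdrop (i - 1) s) (sdrop (j - 1) s)"
      using word_less_linear[of "sdrop (i - 1) s" "sdrop (j - 1) s" \<sigma>] by (metis less_asym less_irrefl)
  qed
  ultimately show ?thesis unfolding patterns_of_length_def by blast
qed

theorem theorem2p1:
  fixes k n :: nat and \<sigma> :: "sign list" and \<pi> :: "nat list"
  assumes "k \<ge> 2" and "length \<sigma> = k" and "\<sigma> \<noteq> replicate k Minus"
    and "n \<ge> 1" and "\<pi> \<in> perms n"
  shows "\<pi> \<in> patterns \<sigma> \<longleftrightarrow> hat \<pi> \<in> cyclic_segmented_perms \<sigma>"
  unfolding hat_in_cyclic_segmented_perms_iff[OF assms(5,4)]
proof
  assume "\<pi> \<in> patterns \<sigma>"
  then obtain m s where s: "s \<in> periodic_words (length \<sigma>) m" "\<pi> = periodic_pattern \<sigma> m s"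
    by (auto simp: patterns_def patterns_of_length_def)
  \<comment> \<open>\<open>patterns\<close> collects all lengths, but the length of the list
    \<open>\<pi>\<close> fixes the period.\<close>
  have "m = n"
    using periodic_pattern(1)[OF s(1), of \<sigma>] assms(5) s(2) unfolding perms_iff by simp
  then show "\<exists>\<phi>. labelling \<sigma> n (cycle_of_list \<pi>) \<phi>"
    using pattern_imp_labelling[OF s(1)] s(2) by simp
next
  assume "\<exists>\<phi>. labelling \<sigma> n (cycle_of_list \<pi>) \<phi>"
  then obtain \<phi> where \<phi>: "labelling \<sigma> n (cycle_of_list \<pi>) \<phi>" by blast
  interpret cyclic_map n "cycle_of_list \<pi>" using assms(5) by (rule cyclic_map_cycle_of_list)
  \<comment> \<open>Here the hypothesis that not all signs are negative enters: it supplies the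
    positive letter needed for moving a boundary.\<close>
  have "\<exists>b<k. \<sigma> ! b \<noteq> Minus"
    using assms(2,3) by (metis length_replicate nth_equalityI nth_replicate)
  then obtain b where "b < length \<sigma>" "b \<notin> neg_letters \<sigma>"
    using assms(2) by (auto simp: neg_letters_def)
  then obtain \<psi> where "labelling \<sigma> n (cycle_of_list \<pi>) \<psi>"
    "inj_on (itinerary (cycle_of_list \<pi>) \<psi>) {1..n}"
    using ex_labelling_inj_itinerary[OF \<phi> assms(4)] by blast
  then have "\<pi> \<in> patterns_of_length \<sigma> n" by (rule labelling_imp_pattern[OF assms(5,4)])
  then show "\<pi> \<in> patterns \<sigma>" using assms(4) by (auto simp: patterns_def)
qed

end
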